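(* Let $\langle(p^{(t)},c_t,a_t)\mid t\in\mathbb{N}^0\rangle$ be an LDO-LC problem and suppose that for some $T\in\mathbb{N}^0$ it is the case that $a_T\ge 0$. Given $x,y\in X$ with $y>x$, let $\langle x_t\mid t\ge T\rangle\in\mathcal{F}^T(x)$, and let $\langle y_t\mid t\ge T\rangle$ be such that $y_T=y$ and $y_t=x_t$ for all $t>T$. Then $\langle y_t\mid t\ge T\rangle\in\mathcal{F}^T(y)$.
   Context: $\mathbb{N}$ is the set of strictly positive integers and $\mathbb{N}^0=\mathbb{N}\cup\{0\}$. Fix a real number $b>0$ and let $X=[0,b]\subset\mathbb{R}$. A linear dynamic optimization problem with linear constraints (LDO-LC problem) $\langle(p^{(t)},c_t,a_t)\mid t\in\mathbb{N}^0\rangle$ is given by real sequences with $c_t\ge 0$ and $c_t+a_tb\ge 0$ for all $t\in\mathbb{N}^0$, $\sum_{t=0}^\infty|c_t|<+\infty$, $\sum_{t=0}^\infty|a_t|<+\infty$ and $\sum_{t=0}^\infty|p^{(t)}|<+\infty$. (These imply $c_t+a_tx\ge 0$ for all $x\in X$.) For $t\in\mathbb{N}^0$ and $x\in X$, let $\Omega_t(x)=\{y\in[0,b]\mid y\le c_t+a_tx\}=[0,\min\{c_t+a_tx,b\}]$. For $x\in X$ and $T\in\mathbb{N}^0$, $\mathcal{F}^T(x)$ is the set of trajectories starting at $x$ at time-period $T$, i.e. of all sequences $\langle x_t\mid t\ge T\rangle$ in $X$ with $x_T=x$ and $x_{t+1}\in\Omega_t(x_t)$ for all $t\ge T$. 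*)

theory Defs
  imports Complex_Main
begin

definition state_space :: "real \<Rightarrow> real set" where
  "state_space b = {0..b}"

definition LDO_LC :: "real \<Rightarrow> (nat \<Rightarrow> real) \<Rightarrow> (nat \<Rightarrow> real) \<Rightarrow> (nat \<Rightarrow> real) \<Rightarrow> bool" where
  "LDO_LC b p c a \<longleftrightarrow>
     (\<forall>t. c t \<ge> 0 \<and> c t + a t * b \<ge> 0) \<and>
     summable (\<lambda>t. \<bar>c t\<bar>) \<and> summable (\<lambda>t. \<bar>a t\<bar>) \<and> summable (\<lambda>t. \<bar>p t\<bar>)"

definition Omega :: "real \<Rightarrow> (nat \<Rightarrow> real) \<Rightarrow> (nat \<Rightarrow> real) \<Rightarrow> nat \<Rightarrow> real \<Rightarrow> real set" where
  "Omega b c a t x = {y \<in> {0..b}. y \<le> c t + a t * x}"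

(* A sequence indexed by t \<ge> T is encoded as a function on all of nat whose
   values below T are irrelevant and left unconstrained. *)
definition trajectories ::
  "real \<Rightarrow> (nat \<Rightarrow> real) \<Rightarrow> (nat \<Rightarrow> real) \<Rightarrow> nat \<Rightarrow> real \<Rightarrow> (nat \<Rightarrow> real) set" where
  "trajectories b c a T x =
     {xs. (\<forall>t\<ge>T. xs t \<in> state_space b) \<and> xs T = x \<and>
          (\<forall>t\<ge>T. xs (Suc t) \<in> Omega b c a t (xs t))}"

end

theory Submission
  imports Defs
begin

text \<open>Raising the initial state alters only the transition out of period \<open>T\<close>.
  Since \<open>a T\<close> is nonnegative, the upper bound \<open>c T + a T * x\<close> can only
  grow when \<open>x\<close> is replaced by \<open>y\<close>, so the old successor stays feasible
  (\<open>Omega_mono\<close>).\<close>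

lemma Omega_mono:
  assumes "a t \<ge> 0" and "x \<le> y"
  shows "Omega b c a t x \<subseteq> Omega b c a t y"
proof -
  have "a t * x \<le> a t * y" using assms by (simp add: mult_left_mono)
  then show ?thesis by (auto simp: Omega_def)
qed

theorem proposition3:
  fixes b :: real and p c a :: "nat \<Rightarrow> real" and T :: nat
    and x y :: real and xs ys :: "nat \<Rightarrow> real"
  assumes "b > 0"
    and "LDO_LC b p c a"
    and "a T \<ge> 0"
    and "x \<in> state_space b" and "y \<in> state_space b" and "y > x"
    and "xs \<in> trajectories b c a T x"
    and "ys T = y" and "\<forall>t>T. ys t = xs t"
  shows "ys \<in> trajectories b c a T y"
proof -
  have xs: "\<And>t. t \<ge> T \<Longrightarrow> xs t \<in> state_space b" "xs T = x"
    "\<And>t. t \<ge> T \<Longrightarrow> xs (Suc t) \<in> Omega b c a t (xs t)"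
    using assms(7) by (auto simp: trajectories_def)
  have "ys t \<in> state_space b" if "t \<ge> T" for t
    using that xs(1) assms(5,8,9) by (cases "t = T") auto
  moreover have "ys (Suc t) \<in> Omega b c a t (ys t)" if "t \<ge> T" for t
  proof (cases "t = T")
    case True
    \<comment> \<open>The target is still \<open>xs (Suc T)\<close>, because
      \<open>Suc T > T\<close>; only the source moves, from \<open>x\<close> up to
      \<open>y\<close>.\<close>
    then show ?thesis
      using xs(3)[of T] xs(2) Omega_mono[of a T x y b c] assms(3,6,8,9) by auto
  next
    case False
    \<comment> \<open>Here \<open>t > T\<close>, so source and target both agree with
      \<open>xs\<close>.\<close>
    then show ?thesis using that xs(3)[of t] assms(9) by simp
  qed
  ultimately show ?thesis using assms(8) by (simp add: trajectories_def)
qed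

end
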